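(* Let $\sigma\in\mathcal{M}^+(\mathbb{R}^n)$, $0<q<1$, and $0\le\alpha<n$. There exists a constant $\varkappa>0$ such that $$\|M_\alpha\nu\|_{L^q(\sigma)}\le\varkappa\,\|\nu\|\quad\text{for all }\nu\in\mathcal{M}^+(\mathbb{R}^n)$$ if and only if there exists a function $u\not\equiv0$ such that $$u\in L^q(\sigma)\quad\text{and}\quad u\ge M_\alpha(u^q\,d\sigma).$$ Moreover, $u$ can be constructed as follows: $u=\lim_{j\to\infty}u_j$, where $u_0:=(M_\alpha\sigma)^{\frac1{1-q}}$, $u_{j+1}\ge u_j$, and $$u_{j+1}:=M_\alpha(u_j^q\,d\sigma),\quad j=0,1,\dots.$$ In particular, $u\ge(M_\alpha\sigma)^{\frac1{1-q}}$.
   Context: $\mathcal{M}^+(\mathbb{R}^n)$ is the class of positive (i.e. nonnegative) locally finite Borel measures on $\mathbb{R}^n$, and $\|\nu\|=\nu(\mathbb{R}^n)$. The fractional maximal operator is $M_\alpha\nu(x)=\sup_{Q\ni x}\frac{\nu(Q)}{|Q|^{1-\alpha/n}}$, $x\in\mathbb{R}^n$, the supremum being over all cubes $Q\subset\mathbb{R}^n$ containing $x$, where $|Q|$ is the Lebesgue measure of $Q$. For a function $f$, $M_\alpha(f\,d\sigma)(x)=\sup_{Q\ni x}|Q|^{-(1-\alpha/n)}\int_Q |f|\,d\sigma$. Also $\|f\|_{L^q(\sigma)}=(\int|f|^q\,d\sigma)^{1/q}$.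
   Formalization: The measure σ is assumed nonzero (for σ = 0 the inequality holds but the constructed u is 0), and u ≢ 0 is read as "not σ-a.e. zero", since the indicator of a σ-null point would otherwise always qualify. *)

theory Defs
  imports "HOL-Analysis.Analysis"
begin

definition loc_fin_measures :: "(real ^ 'n) measure set" where
  "loc_fin_measures =
     {\<nu>. sets \<nu> = sets borel \<and>
          (\<forall>x. \<exists>U. open U \<and> x \<in> U \<and> emeasure \<nu> U < \<infinity>)}"

text \<open>Cubes have sides parallel to the axes and positive side length. Closed cubes are used; by inner
  and outer approximation, open or half-open cubes give the same maximal functions.\<close>

definition cubes :: "(real ^ 'n) set set" where
  "cubes = {Q. \<exists>a. \<exists>h>0. Q = cbox a (\<chi> i. a $ i + h)}"

definition cube_weight :: "real \<Rightarrow> (real ^ 'n) set \<Rightarrow> ennreal" where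
  "cube_weight \<alpha> Q = ennreal (measure lborel Q powr (1 - \<alpha> / real CARD('n)))"

definition frac_max :: "real \<Rightarrow> (real ^ 'n) measure \<Rightarrow> real ^ 'n \<Rightarrow> ennreal" where
  "frac_max \<alpha> \<nu> x = (SUP Q \<in> {Q \<in> cubes. x \<in> Q}. emeasure \<nu> Q / cube_weight \<alpha> Q)"

text \<open>The maximal function of \<open>f d\<sigma>\<close>. Functions take values in \<open>[0, \<infinity>]\<close>, so no absolute
  value is needed.\<close>

definition frac_max_fun ::
  "real \<Rightarrow> (real ^ 'n \<Rightarrow> ennreal) \<Rightarrow> (real ^ 'n) measure \<Rightarrow> real ^ 'n \<Rightarrow> ennreal" where
  "frac_max_fun \<alpha> f \<sigma> x =
     (SUP Q \<in> {Q \<in> cubes. x \<in> Q}. (\<integral>\<^sup>+y\<in>Q. f y \<partial>\<sigma>) / cube_weight \<alpha> Q)"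

text \<open>Powers on \<open>[0, \<infinity>]\<close>, meant for exponents \<open>p > 0\<close> only (so that \<open>\<infinity>\<close> is sent to \<open>\<infinity>\<close>).\<close>

definition enn_powr :: "ennreal \<Rightarrow> real \<Rightarrow> ennreal" where
  "enn_powr t p = (if t = \<infinity> then \<infinity> else ennreal (enn2real t powr p))"

definition Lq_norm :: "real \<Rightarrow> 'a measure \<Rightarrow> ('a \<Rightarrow> ennreal) \<Rightarrow> ennreal" where
  "Lq_norm q \<sigma> f = enn_powr (\<integral>\<^sup>+x. enn_powr (f x) q \<partial>\<sigma>) (1 / q)"

definition Lq_space :: "real \<Rightarrow> 'a measure \<Rightarrow> ('a \<Rightarrow> ennreal) set" where
  "Lq_space q \<sigma> = {f \<in> borel_measurable \<sigma>. Lq_norm q \<sigma> f < \<infinity>}"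

primrec max_iter ::
  "real \<Rightarrow> real \<Rightarrow> (real ^ 'n) measure \<Rightarrow> nat \<Rightarrow> real ^ 'n \<Rightarrow> ennreal" where
  "max_iter \<alpha> q \<sigma> 0 = (\<lambda>x. enn_powr (frac_max \<alpha> \<sigma> x) (1 / (1 - q)))"
| "max_iter \<alpha> q \<sigma> (Suc j) = frac_max_fun \<alpha> (\<lambda>y. enn_powr (max_iter \<alpha> q \<sigma> j y) q) \<sigma>"

definition strong_type :: "real \<Rightarrow> real \<Rightarrow> (real ^ 'n) measure \<Rightarrow> bool" where
  "strong_type \<alpha> q \<sigma> \<longleftrightarrow>
     (\<exists>\<kappa>::real. \<kappa> > 0 \<and>
        (\<forall>\<nu>\<in>loc_fin_measures. Lq_norm q \<sigma> (frac_max \<alpha> \<nu>) \<le> ennreal \<kappa> * emeasure \<nu> UNIV))"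

text \<open>Nontriviality of \<open>u\<close> is meant in \<open>L\<^sup>q(\<sigma>)\<close>: a function supported on a nonempty \<open>\<sigma>\<close>-null set
  would satisfy the remaining conditions for every \<open>\<sigma>\<close>. The inequality holds at every point.\<close>

definition supersolution ::
  "real \<Rightarrow> real \<Rightarrow> (real ^ 'n) measure \<Rightarrow> (real ^ 'n \<Rightarrow> ennreal) \<Rightarrow> bool" where
  "supersolution \<alpha> q \<sigma> u \<longleftrightarrow>
     u \<in> Lq_space q \<sigma> \<and> \<not> (AE x in \<sigma>. u x = 0) \<and>
     (\<forall>x. u x \<ge> frac_max_fun \<alpha> (\<lambda>y. enn_powr (u y) q) \<sigma> x)"

end

theory Submission
  imports Defs
begin

text \<open>Sufficiency: put \<open>d\<omega> = u\<^sup>q d\<sigma>\<close>. If \<open>x\<close> lies in a cube \<open>Q\<close> with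
  \<open>\<nu>(Q) > t u(x) |Q|\<^bsup>1 - \<alpha>/n\<^esup>\<close>, then testing \<open>M\<^sub>\<alpha> \<omega> \<le> u\<close> on a large dilate of \<open>Q\<close> bounds the
  \<open>\<omega>\<close>-mass of the fivefold ball around \<open>x\<close> by \<open>C \<nu>(Q) / t\<close>. Hence the Vitali covering lemma gives the
  weak-type bound \<open>\<omega>{M\<^sub>\<alpha> \<nu> > t u} \<le> C \<parallel>\<nu>\<parallel> / t\<close> although \<open>\<omega>\<close> need not be doubling. Summing it over
  the levels \<open>t = 2\<^sup>k \<parallel>\<nu>\<parallel>\<close> gives the strong-type inequality, because \<open>\<omega>\<close> is finite and \<open>q < 1\<close>.

  Necessity: a truncation \<open>v\<close> of \<open>M\<^sub>\<alpha> \<sigma>\<close> satisfies \<open>v\<^bsup>p + 1\<^esup> \<le> M\<^sub>\<alpha>(v\<^sup>p d\<sigma>)\<close>. For \<open>p = q / (1 - q)\<close>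
  the strong-type inequality turns this into \<open>A \<le> K A\<^sup>q\<close> for \<open>A = \<integral> v\<^sup>p d\<sigma> < \<infinity>\<close>, a bound on \<open>A\<close>
  independent of the truncation, so that \<open>u\<^sub>0 \<in> L\<^sup>q(\<sigma>)\<close>. The same absorption bounds all iterates.\<close>

section \<open>Powers on [0, \<infinity>] and absorption of a sublinear bound\<close>

lemma enn_powr_0: "enn_powr 0 p = 0"
  by (simp add: enn_powr_def)

lemma enn_powr_ennreal: "0 \<le> r \<Longrightarrow> enn_powr (ennreal r) p = ennreal (r powr p)"
  by (simp add: enn_powr_def)

lemma enn_powr_eq_top_iff: "enn_powr t p = \<infinity> \<longleftrightarrow> t = \<infinity>"
  by (simp add: enn_powr_def)

lemma enn_powr_eq_0_iff: "enn_powr t p = 0 \<longleftrightarrow> t = 0"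
  by (cases t) (auto simp: enn_powr_def ennreal_eq_0_iff)

lemma enn_powr_mono: "t \<le> s \<Longrightarrow> 0 \<le> p \<Longrightarrow> enn_powr t p \<le> enn_powr s p"
  by (cases t; cases s) (auto simp: enn_powr_def top_unique intro!: ennreal_leI powr_mono2)

lemma enn_powr_powr: "enn_powr (enn_powr t p) r = enn_powr t (p * r)"
  by (cases t) (auto simp: enn_powr_def powr_powr)

lemma enn_powr_one: "enn_powr t 1 = t"
  by (cases t) (auto simp: enn_powr_def)

lemma enn_powr_add: "enn_powr t (p + r) = enn_powr t p * enn_powr t r"
  by (cases t) (auto simp: enn_powr_def powr_add ennreal_mult' ennreal_top_mult)

lemma enn_powr_mult: "enn_powr (s * t) p = enn_powr s p * enn_powr t p"
  by (cases s; cases t)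
    (auto simp: enn_powr_def powr_mult ennreal_mult[symmetric] ennreal_mult_eq_top_iff
      ennreal_mult_top ennreal_top_mult ennreal_eq_0_iff)

text \<open>Raising to \<open>p\<close> and to \<open>1 / p\<close> are monotone and mutually
  inverse, hence a Galois connection. It yields the continuity in \<open>enn_powr_SUP\<close> and
  later moves roots across inequalities.\<close>

lemma enn_powr_le_iff:
  assumes "0 < p"
  shows "enn_powr t p \<le> s \<longleftrightarrow> t \<le> enn_powr s (1 / p)"
proof
  assume "enn_powr t p \<le> s"
  then have "enn_powr (enn_powr t p) (1 / p) \<le> enn_powr s (1 / p)"
    using assms by (intro enn_powr_mono) auto
  then show "t \<le> enn_powr s (1 / p)"
    using assms by (simp add: enn_powr_powr enn_powr_one)
next
  assume "t \<le> enn_powr s (1 / p)"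
  then have "enn_powr t p \<le> enn_powr (enn_powr s (1 / p)) p"
    using assms by (intro enn_powr_mono) auto
  then show "enn_powr t p \<le> s"
    using assms by (simp add: enn_powr_powr enn_powr_one)
qed

lemma enn_powr_SUP:
  assumes "0 < p"
  shows "enn_powr (SUP i\<in>I. f i) p = (SUP i\<in>I. enn_powr (f i) p)"
proof (rule antisym)
  show "enn_powr (SUP i\<in>I. f i) p \<le> (SUP i\<in>I. enn_powr (f i) p)"
    unfolding enn_powr_le_iff[OF assms]
    by (intro SUP_least) (auto simp: enn_powr_le_iff[OF assms, symmetric] intro!: SUP_upper2)
  show "(SUP i\<in>I. enn_powr (f i) p) \<le> enn_powr (SUP i\<in>I. f i) p"
    using assms by (intro SUP_least enn_powr_mono SUP_upper) auto
qed

lemma borel_measurable_enn_powr [measurable (raw)]: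
  assumes [measurable]: "f \<in> borel_measurable M"
  shows "(\<lambda>x. enn_powr (f x) p) \<in> borel_measurable M"
  unfolding enn_powr_def by measurable

text \<open>Dividing by the positive finite number A^q leaves A^(1 - q) \<le> K. Finiteness of
  \<open>A\<close> has to be known beforehand, since \<infinity> satisfies the inequality for every
  K > 0; this forces the truncations used for necessity.\<close>

lemma enn_powr_absorb:
  assumes "0 \<le> K" and "0 < q" and "q < 1" and "A < \<infinity>" and "A \<le> ennreal K * enn_powr A q"
  shows "A \<le> ennreal (K powr (1 / (1 - q)))"
proof (cases A)
  case (real a)
  show ?thesis
  proof (cases "a = 0")
    case False
    with real have a: "0 < a" by simp
    have "ennreal a \<le> ennreal (K * a powr q)"
      using assms(1,5) real by (simp add: enn_powr_ennreal ennreal_mult)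
    then have "a \<le> K * a powr q"
      using assms(1) by (subst (asm) ennreal_le_iff) auto
    moreover have "a = a powr (1 - q) * a powr q"
      using a by (simp add: powr_add[symmetric])
    ultimately have "a powr (1 - q) * a powr q \<le> K * a powr q"
      by linarith
    then have "a powr (1 - q) \<le> K"
      using a by (auto dest: mult_right_le_imp_le)
    then have "(a powr (1 - q)) powr (1 / (1 - q)) \<le> K powr (1 / (1 - q))"
      using assms by (intro powr_mono2) auto
    then show ?thesis
      using a assms real by (simp add: powr_powr)
  qed (use real in simp)
qed (use assms in simp)

section \<open>Cube weights, distances and local finiteness\<close>

lemma ennreal_divide_le_iff:
  fixes a b w :: ennreal
  assumes "0 < w" and "w < \<infinity>"
  shows "a / w \<le> b \<longleftrightarrow> a \<le> b * w"
proof
  assume "a / w \<le> b"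
  then have "a / w * w \<le> b * w"
    by (rule mult_right_mono) simp
  then show "a \<le> b * w"
    using assms by (simp add: ennreal_divide_times)
next
  assume "a \<le> b * w"
  then show "a / w \<le> b"
    using assms by (intro divide_le_posI_ennreal) (auto simp: mult.commute)
qed

lemma ennreal_less_divide_iff:
  fixes a b w :: ennreal
  assumes "0 < w" and "w < \<infinity>"
  shows "b < a / w \<longleftrightarrow> b * w < a"
  using ennreal_divide_le_iff[OF assms] by (meson not_le)

lemma cube_weight_cbox:
  fixes a :: "real ^ 'n"
  assumes "0 < h"
  shows "cube_weight \<alpha> (cbox a (\<chi> i. a $ i + h)) = ennreal (h powr (real CARD('n) - \<alpha>))"
proof -
  have "cbox a (\<chi> i. a $ i + h) \<noteq> {}"
    using assms by (auto simp: interval_ne_empty_cart)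
  then have "measure lborel (cbox a (\<chi> i. a $ i + h)) = h powr real CARD('n)"
    using assms by (simp add: content_cbox_cart powr_realpow)
  then show ?thesis
    by (simp add: cube_weight_def powr_powr right_diff_distrib)
qed

lemma cube_weight_pos_finite:
  assumes "Q \<in> cubes"
  shows "0 < cube_weight \<alpha> Q" and "cube_weight \<alpha> Q < \<infinity>"
  using assms by (auto simp: cubes_def cube_weight_cbox)

lemma cubes_borel: "Q \<in> cubes \<Longrightarrow> Q \<in> sets borel"
  by (auto simp: cubes_def)

lemma cubes_compact: "Q \<in> cubes \<Longrightarrow> compact Q"
  by (auto simp: cubes_def)

text \<open>Passing through the l^1 norm costs a factor n instead of its square root, which only
  affects constants.\<close>

lemma dist_le_card_mult_cart:
  fixes x y :: "real ^ 'n"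
  assumes "\<And>i. \<bar>x $ i - y $ i\<bar> \<le> h"
  shows "dist x y \<le> real CARD('n) * h"
proof -
  have "dist x y \<le> (\<Sum>i\<in>UNIV. \<bar>(x - y) $ i\<bar>)"
    unfolding dist_norm by (rule norm_le_l1_cart)
  also have "\<dots> \<le> (\<Sum>i\<in>(UNIV::'n set). h)"
    using assms by (intro sum_mono) auto
  finally show ?thesis by simp
qed

lemma loc_fin_finite_on_compact:
  assumes "\<nu> \<in> loc_fin_measures" and "compact K"
  shows "emeasure \<nu> K < \<infinity>"
proof -
  have s: "sets \<nu> = sets borel"
    using assms by (simp add: loc_fin_measures_def)
  obtain U where U: "\<And>x. open (U x)" "\<And>x. x \<in> U x" "\<And>x. emeasure \<nu> (U x) < \<infinity>"
    using assms(1) unfolding loc_fin_measures_def by simp metis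
  obtain F where F: "finite F" "K \<subseteq> (\<Union>x\<in>F. U x)"
  proof (rule compactE_image[OF assms(2)])
    show "K \<subseteq> (\<Union>x\<in>UNIV. U x)"
      using U(2) by blast
  qed (use U(1) that in auto)
  have "emeasure \<nu> K \<le> emeasure \<nu> (\<Union>x\<in>F. U x)"
    using F U(1) by (intro emeasure_mono) (auto simp: s)
  also have "\<dots> \<le> (\<Sum>x\<in>F. emeasure \<nu> (U x))"
    using F(1) U(1) by (intro emeasure_subadditive_finite) (auto simp: s)
  also have "\<dots> < \<infinity>"
    using F(1) U(3) by simp
  finally show ?thesis .
qed

section \<open>The localised maximal function and its lower semicontinuity\<close>

text \<open>For a ball \<open>S\<close> only cubes of bounded side compete, and the function
  vanishes off \<open>S\<close>. The first keeps the radii bounded for the Vitali covering lemma;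
  the second, with a truncation in height, gives functions whose positive powers are integrable
  against a locally finite measure.\<close>

definition local_max ::
  "(real ^ 'n) set \<Rightarrow> real \<Rightarrow> (real ^ 'n) measure \<Rightarrow> real ^ 'n \<Rightarrow> ennreal" where
  "local_max S \<alpha> \<nu> x =
     (SUP Q \<in> {Q \<in> cubes. Q \<subseteq> S \<and> x \<in> Q}. emeasure \<nu> Q / cube_weight \<alpha> Q)"

lemma frac_max_eq_local_max: "frac_max \<alpha> \<nu> = local_max UNIV \<alpha> \<nu>"
  by (auto simp: frac_max_def local_max_def)

lemma local_max_eq_0: "x \<notin> S \<Longrightarrow> local_max S \<alpha> \<nu> x = 0"
proof -
  assume "x \<notin> S"
  then have "{Q \<in> cubes. Q \<subseteq> S \<and> x \<in> Q} = {}"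
    by blast
  then show ?thesis
    by (simp only: local_max_def image_empty Sup_empty bot_ennreal)
qed

lemma local_max_upper:
  "Q \<in> cubes \<Longrightarrow> Q \<subseteq> S \<Longrightarrow> x \<in> Q \<Longrightarrow> emeasure \<nu> Q / cube_weight \<alpha> Q \<le> local_max S \<alpha> \<nu> x"
  unfolding local_max_def by (rule SUP_upper) auto

lemma local_max_mono: "S \<subseteq> T \<Longrightarrow> local_max S \<alpha> \<nu> x \<le> local_max T \<alpha> \<nu> x"
  unfolding local_max_def by (rule SUP_subset_mono) auto

text \<open>Every cube is compact and so competes already inside some ball around 0.\<close>

lemma frac_max_eq_SUP: "frac_max \<alpha> \<nu> x = (SUP N::nat. local_max (ball 0 (real N)) \<alpha> \<nu> x)"
proof (rule antisym)
  show "(SUP N::nat. local_max (ball 0 (real N)) \<alpha> \<nu> x) \<le> frac_max \<alpha> \<nu> x"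
    unfolding frac_max_eq_local_max by (intro SUP_least local_max_mono) auto
  show "frac_max \<alpha> \<nu> x \<le> (SUP N::nat. local_max (ball 0 (real N)) \<alpha> \<nu> x)"
    unfolding frac_max_def
  proof (rule SUP_least, clarify)
    fix Q :: "(real ^ 'a) set" assume Q: "Q \<in> cubes" "x \<in> Q"
    obtain b where b: "\<And>y. y \<in> Q \<Longrightarrow> norm y \<le> b"
      using compact_imp_bounded[OF cubes_compact[OF Q(1)]] unfolding bounded_iff by blast
    obtain N :: nat where "b < real N"
      using reals_Archimedean2 by blast
    then have "Q \<subseteq> ball 0 (real N)"
      using b by (force simp: subset_iff)
    then show "emeasure \<nu> Q / cube_weight \<alpha> Q \<le> (SUP N::nat. local_max (ball 0 (real N)) \<alpha> \<nu> x)"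
      using Q by (intro SUP_upper2[where i=N] local_max_upper) auto
  qed
qed

text \<open>A strict inequality survives a slight enlargement of the cube: the mass does not drop,
  the weight depends continuously on the side, and the open set \<open>S\<close> leaves room. This
  makes up for cubes being closed: all points near \<open>Q\<close> lie in one competing
  cube.\<close>

lemma cube_enlarge:
  fixes S :: "(real ^ 'n) set"
  assumes "Q \<in> cubes" and "Q \<subseteq> S" and "open S"
    and "sets \<nu> = sets borel" and "t < emeasure \<nu> Q / cube_weight \<alpha> Q"
  obtains Q' where "Q' \<in> cubes" and "Q' \<subseteq> S" and "Q \<subseteq> interior Q'"
    and "t < emeasure \<nu> Q' / cube_weight \<alpha> Q'"
proof -
  obtain a h where h: "0 < h" and Q: "Q = cbox a (\<chi> i. a $ i + h)"
    using assms(1) by (auto simp: cubes_def)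
  define s where "s = real CARD('n) - \<alpha>"
  obtain r where r: "0 < r" and rS: "(\<Union>x\<in>Q. ball x r) \<subseteq> S"
    using compact_subset_open_imp_ball_epsilon_subset cubes_compact assms(1-3) by blast
  have "t * ennreal (h powr s) < emeasure \<nu> Q"
    using assms(5) unfolding ennreal_less_divide_iff[OF cube_weight_pos_finite[OF assms(1)]]
    by (simp add: Q cube_weight_cbox h s_def)
  \<comment> \<open>\<open>t\<close> is finite, being strictly below another value, so
    multiplication by it is continuous.\<close>
  moreover have "((\<lambda>e. t * ennreal ((h + 2 * e) powr s)) \<longlongrightarrow> t * ennreal ((h + 2 * 0) powr s)) (at_right 0)"
    using h assms(5) by (intro ennreal_tendsto_cmult tendsto_ennrealI tendsto_intros) auto
  ultimately have "eventually (\<lambda>e. t * ennreal ((h + 2 * e) powr s) < emeasure \<nu> Q) (at_right 0)"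
    by (intro order_tendstoD) auto
  moreover have "eventually (\<lambda>e. e < r / real CARD('n)) (at_right 0)"
    using r by (intro eventually_at_right_real eventually_at_rightI[where b="r / real CARD('n)"]) auto
  moreover have "eventually (\<lambda>e. 0 < e) (at_right (0::real))"
    by (rule eventually_at_right_less)
  ultimately have "eventually (\<lambda>e. t * ennreal ((h + 2 * e) powr s) < emeasure \<nu> Q \<and>
      e < r / real CARD('n) \<and> 0 < e) (at_right 0)"
    by eventually_elim auto
  then obtain e where te: "t * ennreal ((h + 2 * e) powr s) < emeasure \<nu> Q"
    and er: "e < r / real CARD('n)" and e: "0 < e"
    using eventually_happens' trivial_limit_at_right_real by blast
  define b :: "real ^ 'n" where "b = (\<chi> i. a $ i - e)"
  define Q' where "Q' = cbox b (\<chi> i. b $ i + (h + 2 * e))"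
  have cube: "Q' \<in> cubes"
    unfolding cubes_def Q'_def using h e by (auto intro!: exI[of _ b] exI[of _ "h + 2 * e"])
  have int: "Q \<subseteq> interior Q'"
    using e by (auto simp: Q Q'_def interior_cbox mem_box_cart b_def less_eq_real_def)
       (smt (verit, best))+
  have "y \<in> S" if "y \<in> Q'" for y
  proof -
    \<comment> \<open>\<open>x\<close> is the coordinatewise projection of \<open>y\<close> onto
      \<open>Q\<close>. It moves each coordinate by at most \<open>e < r / n\<close>, so that the
      factor n of \<open>dist_le_card_mult_cart\<close> still leaves a distance below
      \<open>r\<close>.\<close>
    define x :: "real ^ 'n" where "x = (\<chi> i. max (a $ i) (min (y $ i) (a $ i + h)))"
    have "x \<in> Q"
      using h by (auto simp: Q x_def mem_box_cart)
    moreover have "dist x y \<le> real CARD('n) * e"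
    proof (rule dist_le_card_mult_cart)
      fix i
      have "a $ i - e \<le> y $ i" "y $ i \<le> a $ i + h + e"
        using that by (auto simp: Q'_def b_def mem_box_cart algebra_simps dest: spec[of _ i])
      then show "\<bar>x $ i - y $ i\<bar> \<le> e"
        using h e by (auto simp: x_def)
    qed
    moreover have "real CARD('n) * e < r"
      using er by (simp add: field_simps)
    ultimately show ?thesis
      using rS by (force simp: subset_iff)
  qed
  moreover have "emeasure \<nu> Q \<le> emeasure \<nu> Q'"
    using int interior_subset cubes_borel[OF cube] assms(4) by (intro emeasure_mono) auto
  then have "t * cube_weight \<alpha> Q' < emeasure \<nu> Q'"
    using te h e by (simp add: Q'_def cube_weight_cbox s_def)
  then have "t < emeasure \<nu> Q' / cube_weight \<alpha> Q'"
    by (simp only: ennreal_less_divide_iff[OF cube_weight_pos_finite[OF cube]])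
  ultimately show ?thesis
    using that cube int by blast
qed

text \<open>The function is lower semicontinuous: by \<open>cube_enlarge\<close> each superlevel set
  contains, around each of its points, the interior of a competing cube.\<close>

lemma borel_measurable_local_max:
  assumes "open S" and "sets \<nu> = sets borel"
  shows "local_max S \<alpha> \<nu> \<in> borel_measurable borel"
proof (rule borel_measurableI_greater)
  fix t
  have "\<exists>T. open T \<and> x \<in> T \<and> T \<subseteq> {x. t < local_max S \<alpha> \<nu> x}" if t: "t < local_max S \<alpha> \<nu> x" for x
  proof -
    obtain Q where Q: "Q \<in> cubes" "Q \<subseteq> S" "x \<in> Q" "t < emeasure \<nu> Q / cube_weight \<alpha> Q"
      using t unfolding local_max_def less_SUP_iff by blast
    obtain Q' where Q': "Q' \<in> cubes" "Q' \<subseteq> S" "Q \<subseteq> interior Q'"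
      "t < emeasure \<nu> Q' / cube_weight \<alpha> Q'"
      using cube_enlarge[OF Q(1,2) assms Q(4)] by blast
    have "t < local_max S \<alpha> \<nu> y" if "y \<in> interior Q'" for y
      using that interior_subset Q' by (intro less_le_trans[OF Q'(4) local_max_upper]) auto
    then show ?thesis
      using Q(3) Q'(3) by (intro exI[of _ "interior Q'"]) auto
  qed
  then have "open {x. t < local_max S \<alpha> \<nu> x}"
    by (subst open_subopen) blast
  then show "{x \<in> space borel. t < local_max S \<alpha> \<nu> x} \<in> sets borel"
    by simp
qed

lemma borel_measurable_frac_max:
  "sets \<nu> = sets borel \<Longrightarrow> frac_max \<alpha> \<nu> \<in> borel_measurable borel"
  by (simp add: frac_max_eq_local_max borel_measurable_local_max)

section \<open>Maximal functions of densities and monotonicity of the iterates\<close>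

lemma frac_max_fun_eq_density:
  assumes "sets \<sigma> = sets borel" and "f \<in> borel_measurable borel"
  shows "frac_max_fun \<alpha> f \<sigma> = frac_max \<alpha> (density \<sigma> f)"
proof -
  have f: "f \<in> borel_measurable \<sigma>"
    using assms measurable_cong_sets by blast
  show ?thesis
    unfolding frac_max_fun_def frac_max_def
    by (intro ext SUP_cong refl) (auto simp: emeasure_density[OF f] cubes_borel assms(1))
qed

lemma borel_measurable_frac_max_fun:
  "sets \<sigma> = sets borel \<Longrightarrow> f \<in> borel_measurable borel \<Longrightarrow> frac_max_fun \<alpha> f \<sigma> \<in> borel_measurable borel"
  by (simp add: frac_max_fun_eq_density borel_measurable_frac_max)

lemma frac_max_fun_mono:
  "(\<And>y. f y \<le> g y) \<Longrightarrow> frac_max_fun \<alpha> f \<sigma> x \<le> frac_max_fun \<alpha> g \<sigma> x"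
  unfolding frac_max_fun_def
  by (intro SUP_mono' divide_right_mono_ennreal nn_integral_mono mult_right_mono) auto

text \<open>A cube Q \<subseteq> S through x with quotient a = \<sigma>(Q) / |Q|^(1 - \<alpha>/n)
  competes at each of its points, so v \<ge> min a K on Q. Hence the quotient of v^p d\<sigma> over
  Q is at least a (min a K)^p \<ge> (min a K)^(p + 1).\<close>

lemma frac_max_fun_truncated_ge:
  assumes "sets \<sigma> = sets borel" and "0 < p"
    and v: "\<And>x. v x = min (local_max S \<alpha> \<sigma> x) K"
  shows "enn_powr (v x) (p + 1) \<le> frac_max_fun \<alpha> (\<lambda>y. enn_powr (v y) p) \<sigma> x"
proof -
  define c where "c = frac_max_fun \<alpha> (\<lambda>y. enn_powr (v y) p) \<sigma> x"
  have "min (emeasure \<sigma> Q / cube_weight \<alpha> Q) K \<le> enn_powr c (1 / (p + 1))"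
    if Q: "Q \<in> cubes" "Q \<subseteq> S" "x \<in> Q" for Q
  proof -
    define a where "a = emeasure \<sigma> Q / cube_weight \<alpha> Q"
    have "enn_powr (min a K) (p + 1) \<le> enn_powr (min a K) p * a"
      by (simp add: enn_powr_add enn_powr_one mult_left_mono)
    also have "\<dots> = (\<integral>\<^sup>+y\<in>Q. enn_powr (min a K) p \<partial>\<sigma>) / cube_weight \<alpha> Q"
      using cubes_borel[OF Q(1)] assms(1)
      by (simp add: nn_integral_cmult_indicator a_def ennreal_times_divide)
    also have "\<dots> \<le> (\<integral>\<^sup>+y\<in>Q. enn_powr (v y) p \<partial>\<sigma>) / cube_weight \<alpha> Q"
    proof (intro divide_right_mono_ennreal nn_integral_mono)
      fix y
      have "min a K \<le> v y" if "y \<in> Q"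
        using local_max_upper[OF Q(1,2) that, of \<sigma> \<alpha>] unfolding v a_def
        by (intro min.mono) auto
      then show "enn_powr (min a K) p * indicator Q y \<le> enn_powr (v y) p * indicator Q y"
        using assms(2) by (auto split: split_indicator intro!: enn_powr_mono)
    qed
    also have "\<dots> \<le> c"
      unfolding c_def frac_max_fun_def using Q by (intro SUP_upper) auto
    finally show ?thesis
      using assms(2) by (subst enn_powr_le_iff[symmetric]) (auto simp: a_def)
  qed
  \<comment> \<open>Passing to the supremum over \<open>Q\<close>: either \<open>K\<close> lies
    below the root already, or every quotient does.\<close>
  then have "local_max S \<alpha> \<sigma> x \<le> enn_powr c (1 / (p + 1)) \<or> K \<le> enn_powr c (1 / (p + 1))"
    unfolding local_max_def by (auto simp: min_le_iff_disj intro!: SUP_least)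
  then have "v x \<le> enn_powr c (1 / (p + 1))"
    unfolding v min_le_iff_disj .
  then show ?thesis
    using assms(2) by (subst enn_powr_le_iff) (auto simp: c_def)
qed

text \<open>This is the case p = q / (1 - q) without truncation (\<open>S = UNIV\<close>,
  \<open>K = \<infinity>\<close>): v^p is then \<open>u\<^sub>0\<^sup>q\<close>, and v^(p + 1) is
  \<open>u\<^sub>0\<close>.\<close>

lemma max_iter_0_le_1:
  assumes "sets \<sigma> = sets borel" and "0 < q" and "q < 1"
  shows "max_iter \<alpha> q \<sigma> 0 x \<le> max_iter \<alpha> q \<sigma> (Suc 0) x"
proof -
  have "q / (1 - q) + 1 = 1 / (1 - q)"
    using assms by (simp add: field_simps)
  then show ?thesis
    using frac_max_fun_truncated_ge[of \<sigma> "q / (1 - q)" "local_max UNIV \<alpha> \<sigma>" UNIV \<alpha> \<infinity> x] assms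
    by (simp add: frac_max_eq_local_max enn_powr_powr)
qed

lemma max_iter_mono:
  assumes "sets \<sigma> = sets borel" and "0 < q" and "q < 1"
  shows "max_iter \<alpha> q \<sigma> j x \<le> max_iter \<alpha> q \<sigma> (Suc j) x"
proof (induction j arbitrary: x)
  case 0
  show ?case by (rule max_iter_0_le_1[OF assms])
next
  case (Suc j)
  have "enn_powr (max_iter \<alpha> q \<sigma> j y) q \<le> enn_powr (max_iter \<alpha> q \<sigma> (Suc j) y) q" for y
    using assms(2) by (intro enn_powr_mono Suc.IH) simp
  from frac_max_fun_mono[OF this] show ?case
    by (simp only: max_iter.simps(2))
qed

lemma borel_measurable_max_iter:
  assumes "sets \<sigma> = sets borel"
  shows "max_iter \<alpha> q \<sigma> j \<in> borel_measurable borel"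
proof (induction j)
  case 0
  show ?case
    using borel_measurable_frac_max[OF assms] by simp
next
  case (Suc j)
  then show ?case
    using borel_measurable_frac_max_fun[OF assms] by simp
qed

section \<open>Necessity: integral bounds for the iterates and their limit\<close>

lemma finite_measure_in_loc_fin_measures:
  assumes "sets \<nu> = sets borel" and "emeasure \<nu> UNIV < \<infinity>"
  shows "\<nu> \<in> loc_fin_measures"
  using assms unfolding loc_fin_measures_def by (auto intro!: exI[of _ UNIV])

text \<open>The inequality is tested on \<open>density \<sigma> f\<close>, which is locally finite
  because its total mass is finite. Taking q-th powers gives K = \<kappa>^q and a form that can be
  iterated.\<close>

lemma strong_type_imp_integral_bound:
  fixes \<sigma> :: "(real ^ 'n) measure"
  assumes "strong_type \<alpha> q \<sigma>" and "sets \<sigma> = sets borel" and "0 < q"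
  obtains K :: real where "0 \<le> K" and
    "\<And>f. f \<in> borel_measurable borel \<Longrightarrow> (\<integral>\<^sup>+x. f x \<partial>\<sigma>) < \<infinity> \<Longrightarrow>
      (\<integral>\<^sup>+x. enn_powr (frac_max_fun \<alpha> f \<sigma> x) q \<partial>\<sigma>) \<le> ennreal K * enn_powr (\<integral>\<^sup>+x. f x \<partial>\<sigma>) q"
proof -
  obtain \<kappa> :: real where \<kappa>: "\<kappa> > 0" and
    st: "\<And>\<nu>. \<nu> \<in> loc_fin_measures \<Longrightarrow>
      Lq_norm q \<sigma> (frac_max \<alpha> \<nu>) \<le> ennreal \<kappa> * emeasure \<nu> UNIV"
    using assms(1) unfolding strong_type_def by blast
  have "(\<integral>\<^sup>+x. enn_powr (frac_max_fun \<alpha> f \<sigma> x) q \<partial>\<sigma>) \<le> ennreal (\<kappa> powr q) * enn_powr (\<integral>\<^sup>+x. f x \<partial>\<sigma>) q"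
    if f: "f \<in> borel_measurable borel" and fin: "(\<integral>\<^sup>+x. f x \<partial>\<sigma>) < \<infinity>" for f
  proof -
    have f': "f \<in> borel_measurable \<sigma>"
      using f assms(2) measurable_cong_sets by blast
    have "emeasure (density \<sigma> f) UNIV = (\<integral>\<^sup>+x. f x \<partial>\<sigma>)"
      using f' assms(2) by (simp add: emeasure_density)
    moreover from this have "density \<sigma> f \<in> loc_fin_measures"
      using fin assms(2) by (intro finite_measure_in_loc_fin_measures) auto
    ultimately have "Lq_norm q \<sigma> (frac_max_fun \<alpha> f \<sigma>) \<le> ennreal \<kappa> * (\<integral>\<^sup>+x. f x \<partial>\<sigma>)"
      using st[of "density \<sigma> f"] by (simp add: frac_max_fun_eq_density[OF assms(2) f])
    then show ?thesis
      using assms(3) \<kappa> unfolding Lq_norm_def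
      by (simp add: enn_powr_le_iff enn_powr_mult enn_powr_ennreal)
  qed
  then show ?thesis
    using that[of "\<kappa> powr q"] by simp
qed

text \<open>Absorption bounds the integrals of truncations by a constant that does not depend on the
  truncation, and monotone convergence then removes it.\<close>

lemma strong_type_imp_integral_max_iter_0:
  fixes \<sigma> :: "(real ^ 'n) measure"
  assumes "strong_type \<alpha> q \<sigma>" and "\<sigma> \<in> loc_fin_measures" and "0 < q" and "q < 1"
  shows "(\<integral>\<^sup>+x. enn_powr (max_iter \<alpha> q \<sigma> 0 x) q \<partial>\<sigma>) < \<infinity>"
proof -
  have s: "sets \<sigma> = sets borel"
    using assms(2) by (simp add: loc_fin_measures_def)
  have ms: "g \<in> borel_measurable borel \<Longrightarrow> g \<in> borel_measurable \<sigma>" for g :: "real ^ 'n \<Rightarrow> ennreal"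
    using s measurable_cong_sets by blast
  obtain K :: real where K: "0 \<le> K" and
    bound: "\<And>f. f \<in> borel_measurable borel \<Longrightarrow> (\<integral>\<^sup>+x. f x \<partial>\<sigma>) < \<infinity> \<Longrightarrow>
      (\<integral>\<^sup>+x. enn_powr (frac_max_fun \<alpha> f \<sigma> x) q \<partial>\<sigma>) \<le> ennreal K * enn_powr (\<integral>\<^sup>+x. f x \<partial>\<sigma>) q"
    using strong_type_imp_integral_bound[OF assms(1) s assms(3)] by blast
  \<comment> \<open>With (p + 1) q = p, the q-th power of the truncated inequality has v^p on its
    left, so the integral of v^p appears on both sides of the strong-type bound. The third identity
    identifies \<open>u\<^sub>0\<^sup>q\<close> with the p-th power of the maximal function.\<close>
  define p where "p = q / (1 - q)"
  have p: "0 < p" "(p + 1) * q = p" "1 / (1 - q) * q = p"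
    using assms(3,4) by (auto simp: p_def field_simps)
  \<comment> \<open>Truncation in height and in space: the function is at most \<open>N\<close> and
    vanishes off a ball, so local finiteness makes its p-th power integrable.\<close>
  define v where "v N x = min (local_max (ball 0 (real N)) \<alpha> \<sigma> x) (of_nat N)" for N :: nat and x
  have v_borel: "v N \<in> borel_measurable borel" for N
    unfolding v_def using borel_measurable_local_max[OF open_ball s] by measurable
  have A_le: "(\<integral>\<^sup>+x. enn_powr (v N x) p \<partial>\<sigma>) \<le> ennreal (K powr (1 / (1 - q)))" for N
  proof (rule enn_powr_absorb[OF K assms(3,4)])
    have "(\<integral>\<^sup>+x. enn_powr (v N x) p \<partial>\<sigma>)
        \<le> (\<integral>\<^sup>+x. enn_powr (of_nat N) p * indicator (cball 0 (real N)) x \<partial>\<sigma>)"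
    proof (rule nn_integral_mono)
      fix x
      show "enn_powr (v N x) p \<le> enn_powr (of_nat N) p * indicator (cball 0 (real N)) x"
      proof (cases "x \<in> ball 0 (real N)")
        case True
        then show ?thesis
          using p by (auto simp: v_def intro!: enn_powr_mono)
      next
        case False
        then show ?thesis
          by (simp add: v_def local_max_eq_0 enn_powr_0)
      qed
    qed
    also have "\<dots> = enn_powr (of_nat N) p * emeasure \<sigma> (cball 0 (real N))"
      by (intro nn_integral_cmult_indicator) (simp add: s)
    also have "\<dots> < \<infinity>"
      using loc_fin_finite_on_compact[OF assms(2) compact_cball] enn_powr_eq_top_iff[of "of_nat N" p]
      by (auto simp: ennreal_mult_less_top top.not_eq_extremum)
    finally show fin: "(\<integral>\<^sup>+x. enn_powr (v N x) p \<partial>\<sigma>) < \<infinity>" .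
    have "(\<integral>\<^sup>+x. enn_powr (v N x) p \<partial>\<sigma>)
        \<le> (\<integral>\<^sup>+x. enn_powr (frac_max_fun \<alpha> (\<lambda>y. enn_powr (v N y) p) \<sigma> x) q \<partial>\<sigma>)"
    proof (rule nn_integral_mono)
      fix x
      have "enn_powr (enn_powr (v N x) (p + 1)) q
          \<le> enn_powr (frac_max_fun \<alpha> (\<lambda>y. enn_powr (v N y) p) \<sigma> x) q"
        using assms(3) by (intro enn_powr_mono frac_max_fun_truncated_ge[OF s p(1)]) (auto simp: v_def)
      then show "enn_powr (v N x) p \<le> enn_powr (frac_max_fun \<alpha> (\<lambda>y. enn_powr (v N y) p) \<sigma> x) q"
        by (simp add: enn_powr_powr p)
    qed
    also have "\<dots> \<le> ennreal K * enn_powr (\<integral>\<^sup>+x. enn_powr (v N x) p \<partial>\<sigma>) q"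
      using v_borel[of N] fin by (intro bound) auto
    finally show "(\<integral>\<^sup>+x. enn_powr (v N x) p \<partial>\<sigma>) \<le> ennreal K * enn_powr (\<integral>\<^sup>+x. enn_powr (v N x) p \<partial>\<sigma>) q" .
  qed
  have inc: "v M x \<le> v N x" if "M \<le> N" for M N x
    unfolding v_def using that by (intro min.mono local_max_mono) auto
  have SUP_v: "(SUP N. v N x) = frac_max \<alpha> \<sigma> x" for x
  proof (rule antisym)
    show "(SUP N. v N x) \<le> frac_max \<alpha> \<sigma> x"
      unfolding v_def frac_max_eq_SUP by (intro SUP_mono') auto
    show "frac_max \<alpha> \<sigma> x \<le> (SUP N. v N x)"
      unfolding frac_max_eq_SUP
    proof (rule SUP_least, rule dense_le)
      \<comment> \<open>Being strictly below another value, \<open>c\<close> is finite and thus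
        below some natural number \<open>N\<close>; at index \<open>max M N\<close> neither
        truncation cuts below \<open>c\<close>.\<close>
      fix M c assume c: "c < local_max (ball 0 (real M)) \<alpha> \<sigma> x"
      obtain N where N: "c < of_nat N"
        using ennreal_Ex_less_of_nat less_le_trans[OF c top_greatest] by blast
      have "c \<le> v (max M N) x"
        unfolding v_def
      proof (rule min.boundedI)
        have "c \<le> local_max (ball 0 (real M)) \<alpha> \<sigma> x"
          using c by simp
        also have "\<dots> \<le> local_max (ball 0 (real (max M N))) \<alpha> \<sigma> x"
          by (intro local_max_mono subset_ball) simp
        finally show "c \<le> local_max (ball 0 (real (max M N))) \<alpha> \<sigma> x" .
        have "(of_nat N :: ennreal) \<le> of_nat (max M N)"
          by (intro of_nat_mono) simp
        with N show "c \<le> of_nat (max M N)"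
          by (meson less_imp_le order_trans)
      qed
      then show "c \<le> (SUP N. v N x)"
        by (intro SUP_upper2[where i="max M N"]) auto
    qed
  qed
  have "(\<integral>\<^sup>+x. enn_powr (max_iter \<alpha> q \<sigma> 0 x) q \<partial>\<sigma>) = (\<integral>\<^sup>+x. (SUP N. enn_powr (v N x) p) \<partial>\<sigma>)"
    by (simp add: enn_powr_powr p(3)[simplified] SUP_v enn_powr_SUP[OF p(1), symmetric])
  also have "\<dots> = (SUP N. \<integral>\<^sup>+x. enn_powr (v N x) p \<partial>\<sigma>)"
    using p inc v_borel
    by (intro nn_integral_monotone_convergence_SUP ms) (auto simp: incseq_def le_fun_def intro!: enn_powr_mono)
  also have "\<dots> \<le> ennreal (K powr (1 / (1 - q)))"
    by (intro SUP_least A_le)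
  finally show ?thesis
    using le_less_trans by fastforce
qed

text \<open>The integrals satisfy A(j + 1) \<le> K A(j)^q. Monotonicity of the iterates replaces
  A(j) by A(j + 1) on the right, and absorption gives the same bound for all j. The finiteness it
  asks for propagates by induction from \<open>u\<^sub>0\<close>.\<close>

lemma strong_type_imp_integral_max_iter:
  fixes \<sigma> :: "(real ^ 'n) measure"
  assumes "strong_type \<alpha> q \<sigma>" and "\<sigma> \<in> loc_fin_measures" and "0 < q" and "q < 1"
  obtains C :: real where "\<And>j. (\<integral>\<^sup>+x. enn_powr (max_iter \<alpha> q \<sigma> j x) q \<partial>\<sigma>) \<le> ennreal C"
proof -
  have s: "sets \<sigma> = sets borel"
    using assms(2) by (simp add: loc_fin_measures_def)
  obtain K :: real where K: "0 \<le> K" and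
    bound: "\<And>f. f \<in> borel_measurable borel \<Longrightarrow> (\<integral>\<^sup>+x. f x \<partial>\<sigma>) < \<infinity> \<Longrightarrow>
      (\<integral>\<^sup>+x. enn_powr (frac_max_fun \<alpha> f \<sigma> x) q \<partial>\<sigma>) \<le> ennreal K * enn_powr (\<integral>\<^sup>+x. f x \<partial>\<sigma>) q"
    using strong_type_imp_integral_bound[OF assms(1) s assms(3)] by blast
  define A where "A j = (\<integral>\<^sup>+x. enn_powr (max_iter \<alpha> q \<sigma> j x) q \<partial>\<sigma>)" for j
  have step: "A (Suc j) \<le> ennreal K * enn_powr (A j) q" if "A j < \<infinity>" for j
    using that borel_measurable_max_iter[OF s, of \<alpha> q j] unfolding A_def max_iter.simps(2)
    by (intro bound) auto
  have fin: "A j < \<infinity>" for j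
  proof (induction j)
    case 0
    show ?case
      unfolding A_def by (rule strong_type_imp_integral_max_iter_0[OF assms])
  next
    case (Suc j)
    have "ennreal K * enn_powr (A j) q < \<infinity>"
      using Suc enn_powr_eq_top_iff[of "A j" q]
      by (auto simp: ennreal_mult_less_top top.not_eq_extremum)
    then show ?case
      using step[OF Suc] by (rule le_less_trans[rotated])
  qed
  have inc: "A j \<le> A (Suc j)" for j
    unfolding A_def using assms(3)
    by (intro nn_integral_mono enn_powr_mono max_iter_mono[OF s assms(3,4)]) auto
  have "A j \<le> ennreal (K powr (1 / (1 - q)))" for j
  proof -
    have "A (Suc j) \<le> ennreal K * enn_powr (A (Suc j)) q"
      using inc[of j] assms(3)
      by (intro order_trans[OF step[OF fin]] mult_left_mono enn_powr_mono) auto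
    then show ?thesis
      using enn_powr_absorb[OF K assms(3,4) fin] inc[of j] order_trans by blast
  qed
  then show ?thesis
    using that unfolding A_def by blast
qed

text \<open>Cubes centred at \<open>x\<close> exhaust the space; if all of them were null, so would
  be \<sigma>.\<close>

lemma frac_max_pos:
  fixes \<sigma> :: "(real ^ 'n) measure"
  assumes "sets \<sigma> = sets borel" and "emeasure \<sigma> UNIV \<noteq> 0"
  shows "0 < frac_max \<alpha> \<sigma> x"
proof (rule ccontr)
  assume "\<not> 0 < frac_max \<alpha> \<sigma> x"
  then have z: "frac_max \<alpha> \<sigma> x = 0" by simp
  \<comment> \<open>\<open>Suc N\<close> keeps the side positive at \<open>N = 0\<close>.\<close>
  define Q where "Q N = cbox (\<chi> i. x $ i - real (Suc N)) (\<chi> i. x $ i + real (Suc N))" for N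
  have Qc: "Q N \<in> cubes" for N
    unfolding cubes_def Q_def
    by (auto intro!: exI[of _ "(\<chi> i. x $ i - real (Suc N)) :: real ^ 'n"] exI[of _ "2 * real (Suc N)"]
        arg_cong2[where f=cbox] simp: vec_eq_iff)
  have "emeasure \<sigma> (Q N) = 0" for N
  proof -
    have "emeasure \<sigma> (Q N) / cube_weight \<alpha> (Q N) \<le> 0"
      unfolding z[symmetric] frac_max_def using Qc
      by (intro SUP_upper) (auto simp: Q_def mem_box_cart)
    then show ?thesis
      unfolding ennreal_divide_le_iff[OF cube_weight_pos_finite[OF Qc]] by simp
  qed
  then have "emeasure \<sigma> (\<Union>N. Q N) = 0"
    using Qc assms(1) by (intro emeasure_UN_eq_0) (auto simp: cubes_borel)
  moreover have "(\<Union>N. Q N) = UNIV"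
  proof -
    have "y \<in> (\<Union>N. Q N)" for y
    proof -
      obtain N :: nat where N: "norm (y - x) \<le> real N"
        using real_arch_simple by blast
      have "\<bar>y $ i - x $ i\<bar> \<le> real (Suc N)" for i
        using component_le_norm_cart[of "y - x" i] N by simp
      then have "y \<in> Q N"
        unfolding Q_def mem_box_cart by (simp add: abs_le_iff algebra_simps)
      then show ?thesis by blast
    qed
    then show ?thesis by blast
  qed
  ultimately show False
    using assms(2) by simp
qed

text \<open>Monotone convergence passes to the limit twice: in the uniform integral bound, and in
  the quotient of each cube Q through x, where the quotient for the j-th iterate is below the next
  iterate at x. Nontriviality holds because \<open>u\<^sub>0\<close> is positive at every point and
  \<sigma> is not zero.\<close>

lemma strong_type_imp_supersolution:
  fixes \<sigma> :: "(real ^ 'n) measure"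
  assumes "strong_type \<alpha> q \<sigma>" and "\<sigma> \<in> loc_fin_measures" and "emeasure \<sigma> UNIV \<noteq> 0"
    and "0 < q" and "q < 1"
  shows "supersolution \<alpha> q \<sigma> (\<lambda>x. SUP j. max_iter \<alpha> q \<sigma> j x)" (is "supersolution \<alpha> q \<sigma> ?u")
proof -
  have s: "sets \<sigma> = sets borel"
    using assms(2) by (simp add: loc_fin_measures_def)
  have ms: "g \<in> borel_measurable borel \<Longrightarrow> g \<in> borel_measurable \<sigma>" for g :: "real ^ 'n \<Rightarrow> ennreal"
    using s measurable_cong_sets by blast
  have iter_borel [measurable]: "max_iter \<alpha> q \<sigma> j \<in> borel_measurable borel" for j
    by (rule borel_measurable_max_iter[OF s])
  have inc: "incseq (\<lambda>j. max_iter \<alpha> q \<sigma> j)"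
    by (intro incseq_SucI le_funI max_iter_mono[OF s assms(4,5)])
  have inc_q: "incseq (\<lambda>j x. enn_powr (max_iter \<alpha> q \<sigma> j x) q)"
    using inc assms(4) by (auto simp: incseq_def le_fun_def intro!: enn_powr_mono)
  obtain C :: real where C: "\<And>j. (\<integral>\<^sup>+x. enn_powr (max_iter \<alpha> q \<sigma> j x) q \<partial>\<sigma>) \<le> ennreal C"
    using strong_type_imp_integral_max_iter[OF assms(1,2,4,5)] by blast
  have "(\<integral>\<^sup>+x. enn_powr (?u x) q \<partial>\<sigma>) = (SUP j. \<integral>\<^sup>+x. enn_powr (max_iter \<alpha> q \<sigma> j x) q \<partial>\<sigma>)"
    unfolding enn_powr_SUP[OF assms(4)]
    by (intro nn_integral_monotone_convergence_SUP inc_q ms) measurable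
  also have "\<dots> \<le> ennreal C"
    by (intro SUP_least C)
  finally have "(\<integral>\<^sup>+x. enn_powr (?u x) q \<partial>\<sigma>) \<noteq> \<infinity>"
    by (auto simp: top_unique)
  then have "?u \<in> Lq_space q \<sigma>"
    unfolding Lq_space_def Lq_norm_def
    using enn_powr_eq_top_iff[of "\<integral>\<^sup>+x. enn_powr (?u x) q \<partial>\<sigma>" "1 / q"]
    by (auto simp: top.not_eq_extremum intro!: ms)
  moreover have "?u x \<ge> frac_max_fun \<alpha> (\<lambda>y. enn_powr (?u y) q) \<sigma> x" for x
    unfolding frac_max_fun_def
  proof (rule SUP_least, clarify)
    fix Q :: "(real ^ 'n) set" assume Q: "Q \<in> cubes" "x \<in> Q"
    have "(\<integral>\<^sup>+y\<in>Q. enn_powr (?u y) q \<partial>\<sigma>)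
        = (\<integral>\<^sup>+y. (SUP j. enn_powr (max_iter \<alpha> q \<sigma> j y) q * indicator Q y) \<partial>\<sigma>)"
      by (simp add: enn_powr_SUP[OF assms(4)] SUP_mult_right_ennreal)
    also have "\<dots> = (SUP j. \<integral>\<^sup>+y\<in>Q. enn_powr (max_iter \<alpha> q \<sigma> j y) q \<partial>\<sigma>)"
      using inc_q cubes_borel[OF Q(1)]
      by (intro nn_integral_monotone_convergence_SUP ms)
        (auto simp: incseq_def le_fun_def intro!: mult_right_mono)
    finally have "(\<integral>\<^sup>+y\<in>Q. enn_powr (?u y) q \<partial>\<sigma>) / cube_weight \<alpha> Q
        = (SUP j. (\<integral>\<^sup>+y\<in>Q. enn_powr (max_iter \<alpha> q \<sigma> j y) q \<partial>\<sigma>) / cube_weight \<alpha> Q)"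
      by (simp add: SUP_divide_ennreal)
    also have "\<dots> \<le> ?u x"
    proof (rule SUP_least)
      fix j
      have "(\<integral>\<^sup>+y\<in>Q. enn_powr (max_iter \<alpha> q \<sigma> j y) q \<partial>\<sigma>) / cube_weight \<alpha> Q \<le> max_iter \<alpha> q \<sigma> (Suc j) x"
        using Q by (auto simp: frac_max_fun_def intro!: SUP_upper)
      also have "\<dots> \<le> ?u x"
        by (rule SUP_upper) simp
      finally show "(\<integral>\<^sup>+y\<in>Q. enn_powr (max_iter \<alpha> q \<sigma> j y) q \<partial>\<sigma>) / cube_weight \<alpha> Q \<le> ?u x" .
    qed
    finally show "(\<integral>\<^sup>+y\<in>Q. enn_powr (?u y) q \<partial>\<sigma>) / cube_weight \<alpha> Q \<le> ?u x" .
  qed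
  moreover have "\<not> (AE x in \<sigma>. ?u x = 0)"
  proof
    assume "AE x in \<sigma>. ?u x = 0"
    moreover have "?u x \<noteq> 0" for x
    proof -
      have "max_iter \<alpha> q \<sigma> 0 x \<le> ?u x"
        by (rule SUP_upper) simp
      moreover have "max_iter \<alpha> q \<sigma> 0 x \<noteq> 0"
        using frac_max_pos[OF s assms(3), of \<alpha> x] by (simp add: enn_powr_eq_0_iff)
      ultimately show ?thesis
        by auto
    qed
    ultimately have "AE x in \<sigma>. False"
      by auto
    then have "emeasure \<sigma> (space \<sigma>) = 0"
      by (simp add: AE_iff_measurable[OF sets.top])
    moreover have "space \<sigma> = UNIV"
      using sets_eq_imp_space_eq[OF s] by simp
    ultimately show False
      using assms(3) by simp
  qed
  ultimately show ?thesis
    unfolding supersolution_def by blast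
qed

section \<open>Sufficiency: the weak-type inequality by Vitali covering\<close>

text \<open>Writing the sum as an integral over a counting measure lets the countable set of Vitali
  centres serve as index set without an enumeration; Tonelli's theorem exchanges sum and
  integral.\<close>

lemma emeasure_UN_le_nn_integral_count_space:
  assumes "countable I" and X: "\<And>i. i \<in> I \<Longrightarrow> X i \<in> sets M"
  shows "emeasure M (\<Union>i\<in>I. X i) \<le> (\<integral>\<^sup>+i. emeasure M (X i) \<partial>count_space I)"
proof -
  have "emeasure M (\<Union>i\<in>I. X i) = (\<integral>\<^sup>+x. indicator (\<Union>i\<in>I. X i) x \<partial>M)"
    using assms by (intro nn_integral_indicator[symmetric] sets.countable_UN') auto
  also have "\<dots> \<le> (\<integral>\<^sup>+x. \<integral>\<^sup>+i. indicator (X i) x \<partial>count_space I \<partial>M)"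
  proof (rule nn_integral_mono)
    fix x
    have "1 \<le> (\<integral>\<^sup>+i. indicator (X i) x \<partial>count_space I)" if "i \<in> I" "x \<in> X i" for i
      using nn_integral_ge_point[of i I "\<lambda>i. indicator (X i) x"] that by simp
    then show "indicator (\<Union>i\<in>I. X i) x \<le> (\<integral>\<^sup>+i. indicator (X i) x \<partial>count_space I :: ennreal)"
      by (auto split: split_indicator)
  qed
  also have "\<dots> = (\<integral>\<^sup>+i. \<integral>\<^sup>+x. indicator (X i) x \<partial>M \<partial>count_space I)"
    using assms by (intro nn_integral_count_space_nn_integral) auto
  also have "\<dots> = (\<integral>\<^sup>+i. emeasure M (X i) \<partial>count_space I)"
    using X by (intro nn_integral_cong) auto
  finally show ?thesis .
qed

text \<open>The constant is independent of \<open>R\<close>, which serves to bound the radii in the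
  covering lemma.\<close>

lemma weak_type_local:
  fixes \<nu> \<omega> :: "(real ^ 'n) measure" and u :: "real ^ 'n \<Rightarrow> ennreal"
  assumes u: "\<And>x. frac_max \<alpha> \<omega> x \<le> u x"
    and s: "sets \<omega> = sets borel" "sets \<nu> = sets borel" and t: "0 < t"
  shows "ennreal t * emeasure \<omega> {x. ennreal t * u x < local_max (ball 0 R) \<alpha> \<nu> x}
    \<le> ennreal ((10 * real CARD('n)) powr (real CARD('n) - \<alpha>)) * emeasure \<nu> UNIV"
proof -
  define n where "n = real CARD('n)"
  have n: "0 < n" by (simp add: n_def)
  \<comment> \<open>Ratio of the weights of the cubes \<open>Q'\<close> (side
    \<open>10 * n * h\<close>) and \<open>Q\<close> (side \<open>h\<close>) below.\<close>
  define c where "c = (10 * n) powr (n - \<alpha>)"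
  define E where "E = {x. ennreal t * u x < local_max (ball 0 R) \<alpha> \<nu> x}"
  have "\<exists>r. 0 < r \<and> r \<le> n * (2 * R) \<and>
      ennreal t * emeasure \<omega> (cball x (5 * r)) \<le> ennreal c * emeasure \<nu> (cball x r)" if x: "x \<in> E" for x
  proof -
    obtain Q where Q: "Q \<in> cubes" "Q \<subseteq> ball 0 R" "x \<in> Q" "ennreal t * u x < emeasure \<nu> Q / cube_weight \<alpha> Q"
      using x unfolding E_def local_max_def less_SUP_iff by blast
    obtain a h where h: "0 < h" and Qeq: "Q = cbox a (\<chi> i. a $ i + h)"
      using Q(1) by (auto simp: cubes_def)
    define b :: "real ^ 'n" where "b = (\<chi> i. a $ i + h)"
    have "a \<in> Q" "b \<in> Q"
      using h by (auto simp: Qeq b_def mem_box_cart)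
    then have "norm a < R" "norm b < R"
      using Q(2) by auto
    then have "norm (b - a) \<le> 2 * R"
      using norm_triangle_ineq4[of b a] by linarith
    \<comment> \<open>Every coordinate of \<open>b - a\<close> equals \<open>h\<close>;
      \<open>undefined\<close> stands for an arbitrary index.\<close>
    moreover have "h \<le> norm (b - a)"
      using component_le_norm_cart[of "b - a" undefined] h by (simp add: b_def)
    ultimately have hR: "h \<le> 2 * R"
      by linarith
    have QB: "Q \<subseteq> cball x (n * h)"
    proof
      fix y assume "y \<in> Q"
      have "\<bar>x $ i - y $ i\<bar> \<le> h" for i
        using \<open>y \<in> Q\<close> Q(3) unfolding Qeq mem_box_cart by (auto simp: abs_le_iff dest!: spec[of _ i])
      then show "y \<in> cball x (n * h)"
        unfolding mem_cball n_def by (rule dist_le_card_mult_cart)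
    qed
    \<comment> \<open>\<open>Q'\<close> is the cube centred at \<open>x\<close> with half side
      \<open>5 * n * h\<close>, so it contains the fivefold ball of radius \<open>n * h\<close>. As
      it also contains \<open>x\<close>, the bound by \<open>u x\<close> applies to it.\<close>
    define d :: "real ^ 'n" where "d = (\<chi> i. x $ i - 5 * n * h)"
    define Q' where "Q' = cbox d (\<chi> i. d $ i + 10 * n * h)"
    have h': "0 < 10 * n * h" using n h by simp
    have Q': "Q' \<in> cubes"
      unfolding cubes_def Q'_def using h' by blast
    have BQ': "cball x (5 * (n * h)) \<subseteq> Q'"
    proof
      fix y assume "y \<in> cball x (5 * (n * h))"
      then have "norm (x - y) \<le> 5 * n * h"
        by (simp add: dist_norm)
      then have "\<bar>x $ i - y $ i\<bar> \<le> 5 * n * h" for i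
        using component_le_norm_cart[of "x - y" i] by simp
      then show "y \<in> Q'"
        unfolding Q'_def d_def mem_box_cart by (auto simp: abs_le_iff algebra_simps)
    qed
    have "x \<in> Q'"
      using BQ' n h by auto
    have "emeasure \<omega> (cball x (5 * (n * h))) \<le> emeasure \<omega> Q'"
      using BQ' cubes_borel[OF Q'] s by (intro emeasure_mono) auto
    also have "\<dots> \<le> u x * cube_weight \<alpha> Q'"
    proof -
      have "emeasure \<omega> Q' / cube_weight \<alpha> Q' \<le> frac_max \<alpha> \<omega> x"
        unfolding frac_max_def using Q' \<open>x \<in> Q'\<close> by (intro SUP_upper) auto
      then have "emeasure \<omega> Q' / cube_weight \<alpha> Q' \<le> u x"
        using u order_trans by blast
      then show ?thesis
        by (simp only: ennreal_divide_le_iff[OF cube_weight_pos_finite[OF Q']])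
    qed
    also have "cube_weight \<alpha> Q' = ennreal c * cube_weight \<alpha> Q"
      using n h h' by (simp add: Q'_def Qeq cube_weight_cbox c_def n_def powr_mult ennreal_mult)
    finally have "ennreal t * emeasure \<omega> (cball x (5 * (n * h)))
        \<le> ennreal t * (u x * (ennreal c * cube_weight \<alpha> Q))"
      by (rule mult_left_mono) simp
    also have "\<dots> = ennreal c * (ennreal t * u x * cube_weight \<alpha> Q)"
      by (simp add: ac_simps)
    also have "\<dots> \<le> ennreal c * emeasure \<nu> Q"
      using Q(4) unfolding ennreal_less_divide_iff[OF cube_weight_pos_finite[OF Q(1)]]
      by (intro mult_left_mono) auto
    also have "\<dots> \<le> ennreal c * emeasure \<nu> (cball x (n * h))"
      using QB s by (intro mult_left_mono emeasure_mono) auto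
    finally show ?thesis
      using n h hR by (intro exI[of _ "n * h"]) (auto intro: mult_left_mono)
  qed
  then obtain r where r: "\<And>x. x \<in> E \<Longrightarrow> 0 < r x \<and> r x \<le> n * (2 * R)"
    and rm: "\<And>x. x \<in> E \<Longrightarrow>
      ennreal t * emeasure \<omega> (cball x (5 * r x)) \<le> ennreal c * emeasure \<nu> (cball x (r x))"
    by metis
  have "E \<subseteq> (\<Union>x\<in>E. cball x (r x))"
    using r by fastforce
  \<comment> \<open>The selected balls are disjoint, so their \<nu>-masses add up to at most the
    total mass; their fivefold dilates cover \<open>E\<close> and so control its
    \<omega>-mass.\<close>
  then obtain C where C: "countable C" "C \<subseteq> E"
    and disj: "pairwise (\<lambda>x y. disjnt (cball x (r x)) (cball y (r y))) C"
    and cover: "E \<subseteq> (\<Union>x\<in>C. cball x (5 * r x))"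
    using Vitali_covering_lemma_cballs[of E "\<lambda>x. x" r E, OF _ r] by blast
  have "ennreal t * emeasure \<omega> E \<le> ennreal t * emeasure \<omega> (\<Union>x\<in>C. cball x (5 * r x))"
    using C(1) cover s by (intro mult_left_mono emeasure_mono sets.countable_UN') auto
  also have "\<dots> \<le> ennreal t * (\<integral>\<^sup>+x. emeasure \<omega> (cball x (5 * r x)) \<partial>count_space C)"
    using C(1) s by (intro mult_left_mono emeasure_UN_le_nn_integral_count_space) auto
  also have "\<dots> = (\<integral>\<^sup>+x. ennreal t * emeasure \<omega> (cball x (5 * r x)) \<partial>count_space C)"
    by (simp add: nn_integral_cmult)
  also have "\<dots> \<le> (\<integral>\<^sup>+x. ennreal c * emeasure \<nu> (cball x (r x)) \<partial>count_space C)"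
    using C(2) rm by (intro nn_integral_mono) auto
  also have "\<dots> = ennreal c * (\<integral>\<^sup>+x. emeasure \<nu> (cball x (r x)) \<partial>count_space C)"
    by (simp add: nn_integral_cmult)
  also have "\<dots> = ennreal c * emeasure \<nu> (\<Union>x\<in>C. cball x (r x))"
    using C(1) disj s by (subst emeasure_UN_countable)
      (auto simp: disjoint_family_on_def pairwise_def disjnt_def)
  also have "\<dots> \<le> ennreal c * emeasure \<nu> UNIV"
    using s by (intro mult_left_mono emeasure_mono) auto
  finally show ?thesis
    by (simp add: E_def c_def n_def)
qed

text \<open>The level sets of the localised functions increase to that of \<open>frac_max\<close>,
  and the local bound is uniform in the radius. Measurability of \<open>u\<close> gives measurable
  level sets, hence continuity from below.\<close>

lemma weak_type:
  fixes \<nu> \<omega> :: "(real ^ 'n) measure" and u :: "real ^ 'n \<Rightarrow> ennreal"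
  assumes u: "\<And>x. frac_max \<alpha> \<omega> x \<le> u x" and ub [measurable]: "u \<in> borel_measurable borel"
    and s: "sets \<omega> = sets borel" "sets \<nu> = sets borel" and t: "0 < t"
  shows "ennreal t * emeasure \<omega> {x. ennreal t * u x < frac_max \<alpha> \<nu> x}
    \<le> ennreal ((10 * real CARD('n)) powr (real CARD('n) - \<alpha>)) * emeasure \<nu> UNIV"
proof -
  define E where "E N = {x. ennreal t * u x < local_max (ball 0 (real N)) \<alpha> \<nu> x}" for N :: nat
  have E_sets: "E N \<in> sets \<omega>" for N
  proof -
    have [measurable]: "local_max (ball 0 (real N)) \<alpha> \<nu> \<in> borel_measurable borel"
      by (rule borel_measurable_local_max[OF open_ball s(2)])
    have "{x \<in> space borel. ennreal t * u x < local_max (ball 0 (real N)) \<alpha> \<nu> x} \<in> sets borel"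
      by measurable
    then show ?thesis
      by (simp add: E_def s)
  qed
  have "incseq E"
    unfolding incseq_def E_def
    using less_le_trans[OF _ local_max_mono[OF subset_ball]] by (metis (mono_tags, lifting) Collect_mono of_nat_mono)
  have "{x. ennreal t * u x < frac_max \<alpha> \<nu> x} = (\<Union>N. E N)"
    by (auto simp: E_def frac_max_eq_SUP less_SUP_iff)
  then have "emeasure \<omega> {x. ennreal t * u x < frac_max \<alpha> \<nu> x} = (SUP N. emeasure \<omega> (E N))"
    using SUP_emeasure_incseq[of E \<omega>] E_sets \<open>incseq E\<close> by (simp add: image_subset_iff)
  then show ?thesis
    unfolding E_def
    by (auto simp: SUP_mult_left_ennreal intro!: SUP_least weak_type_local[OF u s t])
qed

section \<open>Sufficiency: from weak type to strong type\<close>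

text \<open>If w < m < \<infinity>, the last level 2^k w below m already gives m \<le> 2^(k + 1) w.
  The proof avoids choosing a last level, and so covers m = \<infinity> too: it compares m with the
  q-th root \<open>T\<close> of the right-hand side.\<close>

lemma enn_powr_le_dyadic_sum:
  fixes m w :: ennreal
  assumes "0 < q" and "0 < w"
  shows "enn_powr m q \<le> enn_powr w q +
    (\<Sum>k. enn_powr (2 ^ Suc k * w) q * (if 2 ^ k * w < m then 1 else 0))" (is "_ \<le> ?S")
proof -
  define T where "T = enn_powr ?S (1 / q)"
  have w: "w \<le> T"
    unfolding T_def enn_powr_le_iff[OF assms(1), symmetric] by simp
  have step: "2 ^ Suc k * w \<le> T" if "2 ^ k * w < m" for k
  proof -
    have "enn_powr (2 ^ Suc k * w) q * (if 2 ^ k * w < m then 1 else 0)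
      \<le> (\<Sum>k. enn_powr (2 ^ Suc k * w) q * (if 2 ^ k * w < m then 1 else 0))"
      using ennreal_suminf_lessD not_less by blast
    also have "\<dots> \<le> ?S"
      by simp
    finally show ?thesis
      using that unfolding T_def enn_powr_le_iff[OF assms(1), symmetric] by simp
  qed
  have "m \<le> T"
  proof (rule ccontr)
    assume "\<not> m \<le> T"
    then have Tm: "T < m" by simp
    \<comment> \<open>A bound 2^k w \<le> T < m switches on the k-th summand, which yields the next
      bound. As w > 0, all these bounds together contradict the finiteness of
      \<open>T\<close>.\<close>
    have all: "2 ^ k * w \<le> T" for k
    proof (induction k)
      case 0
      then show ?case using w by simp
    next
      case (Suc k)
      then show ?case
        using Tm by (intro step) auto
    qed
    obtain r where r: "T = ennreal r" "0 \<le> r"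
      using Tm by (cases T) auto
    obtain v where v: "w = ennreal v" "0 < v"
      using w r assms(2) by (cases w) (auto simp: top_unique)
    obtain k where "r / v < 2 ^ k"
      using real_arch_pow[of 2 "r / v"] by auto
    then have "r < 2 ^ k * v"
      using v by (simp add: field_simps)
    moreover have "ennreal (2 ^ k * v) \<le> ennreal r"
      using all[of k] v r by (simp add: ennreal_mult ennreal_power[symmetric] del: ennreal_power)
    ultimately show False
      using r v by (simp add: ennreal_le_iff2)
  qed
  then show ?thesis
    unfolding T_def enn_powr_le_iff[OF assms(1), symmetric] .
qed

lemma supersolution_imp_strong_type:
  fixes \<sigma> :: "(real ^ 'n) measure"
  assumes sup: "supersolution \<alpha> q \<sigma> u" and s: "sets \<sigma> = sets borel"
    and "0 < q" and "q < 1"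
  shows "strong_type \<alpha> q \<sigma>"
proof -
  have sb: "f \<in> borel_measurable \<sigma> \<longleftrightarrow> f \<in> borel_measurable borel" for f :: "real ^ 'n \<Rightarrow> ennreal"
    using s measurable_cong_sets by blast
  have [measurable]: "u \<in> borel_measurable borel"
    using sup sb by (simp add: supersolution_def Lq_space_def)
  define W where "W = (\<integral>\<^sup>+x. enn_powr (u x) q \<partial>\<sigma>)"
  have "W \<noteq> \<infinity>"
    using sup by (auto simp: supersolution_def Lq_space_def Lq_norm_def W_def enn_powr_def)
  define \<omega> where "\<omega> = density \<sigma> (\<lambda>x. enn_powr (u x) q)"
  have s\<omega>: "sets \<omega> = sets borel"
    by (simp add: \<omega>_def s)
  have \<omega>_eq: "emeasure \<omega> E = (\<integral>\<^sup>+x\<in>E. enn_powr (u x) q \<partial>\<sigma>)" if "E \<in> sets borel" for E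
    unfolding \<omega>_def using that by (intro emeasure_density) (auto simp: sb s)
  have max_le: "frac_max \<alpha> \<omega> x \<le> u x" for x
    using sup unfolding \<omega>_def supersolution_def by (simp add: frac_max_fun_eq_density[OF s])
  have "W \<noteq> 0"
  proof
    assume "W = 0"
    then have "AE x in \<sigma>. enn_powr (u x) q = 0"
      unfolding W_def by (subst (asm) nn_integral_0_iff_AE) (auto simp: sb)
    then show False
      using sup unfolding supersolution_def enn_powr_eq_0_iff by blast
  qed
  moreover have "emeasure \<omega> UNIV = W"
    by (simp add: \<omega>_eq W_def)
  \<comment> \<open>Nontriviality of \<open>u\<close> makes \<omega> nonzero, so \<open>u\<close> is
    positive everywhere; the dyadic sum with base level proportional to \<open>u x\<close> relies on
    this.\<close>
  ultimately have "0 < frac_max \<alpha> \<omega> x" for x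
    by (intro frac_max_pos[OF s\<omega>]) simp
  then have u_pos: "0 < u x" for x
    using max_le less_le_trans by blast
  define C where "C = (10 * real CARD('n)) powr (real CARD('n) - \<alpha>)"
  have C: "0 \<le> C" by (simp add: C_def)
  \<comment> \<open>The k-th term is 2^((k + 1) q) from the dyadic sum times the weak-type bound C /
    2^k; the series is geometric with ratio 2^(q - 1) < 1.\<close>
  define D where "D = (\<Sum>k. ennreal (2 powr q * C * (2 powr (q - 1)) ^ k))"
  have "D \<noteq> \<infinity>"
  proof -
    have "2 powr (q - 1) < 2 powr (0 :: real)"
      using assms(4) by (intro powr_less_mono) auto
    then have "summable (\<lambda>k. 2 powr q * C * (2 powr (q - 1)) ^ k)"
      by (intro summable_mult summable_geometric) auto
    then show ?thesis
      unfolding D_def infinity_ennreal_def using C by (intro ennreal_suminf_neq_top) auto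
  qed
  with \<open>W \<noteq> \<infinity>\<close> obtain b where b: "W + D = ennreal b" "0 \<le> b"
    by (cases "W + D") auto
  \<comment> \<open>The added 1 makes \<kappa> positive from \<open>0 \<le> b\<close> alone.\<close>
  define \<kappa> where "\<kappa> = (b + 1) powr (1 / q)"
  have \<kappa>: "0 < \<kappa>"
    using b by (simp add: \<kappa>_def)
  have "Lq_norm q \<sigma> (frac_max \<alpha> \<nu>) \<le> ennreal \<kappa> * emeasure \<nu> UNIV" if "\<nu> \<in> loc_fin_measures" for \<nu>
  proof -
    have s\<nu>: "sets \<nu> = sets borel"
      using that by (simp add: loc_fin_measures_def)
    have [measurable]: "frac_max \<alpha> \<nu> \<in> borel_measurable borel"
      by (rule borel_measurable_frac_max[OF s\<nu>])
    consider "emeasure \<nu> UNIV = \<infinity>" | "emeasure \<nu> UNIV = 0"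
      | a where "emeasure \<nu> UNIV = ennreal a" "0 < a"
      by (cases "emeasure \<nu> UNIV") (auto simp: less_eq_real_def)
    then show ?thesis
    proof cases
      case 1
      then show ?thesis using \<kappa> by (simp add: ennreal_mult_top)
    next
      case 2
      have "emeasure \<nu> Q = 0" for Q
        using emeasure_mono[of Q UNIV \<nu>] s\<nu> 2 by simp
      then have "frac_max \<alpha> \<nu> x \<le> 0" for x
        unfolding frac_max_def by (intro SUP_least) simp
      then show ?thesis
        by (simp add: Lq_norm_def enn_powr_0)
    next
      case (3 a)
      define A where "A = ennreal a"
      have A: "0 < A" using 3 by (simp add: A_def)
      define E where "E k = {x. 2 ^ k * (A * u x) < frac_max \<alpha> \<nu> x}" for k :: nat
      have E_borel: "E k \<in> sets borel" for k
        unfolding E_def by measurable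
      \<comment> \<open>At level t = 2^k a, with \<open>a\<close> the total mass of \<nu>, the mass
        cancels from the weak-type bound.\<close>
      have weak: "emeasure \<omega> (E k) \<le> ennreal (C / 2 ^ k)" for k
      proof -
        have t: "ennreal (2 ^ k * a) = 2 ^ k * A"
          using 3 by (simp add: A_def ennreal_mult ennreal_power[symmetric] del: ennreal_power)
        have "ennreal (2 ^ k * a) * emeasure \<omega> (E k) \<le> ennreal C * ennreal a"
          using weak_type[OF max_le _ s\<omega> s\<nu>, of "2 ^ k * a"] 3
          by (simp add: C_def E_def t mult.assoc)
        also have "\<dots> = ennreal (2 ^ k * a) * ennreal (C / 2 ^ k)"
          using 3 C by (simp add: ennreal_mult[symmetric] mult.commute)
        finally show ?thesis
          using 3 by (subst (asm) ennreal_mult_le_mult_iff) auto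
      qed
      have "(\<integral>\<^sup>+x. enn_powr (frac_max \<alpha> \<nu> x) q \<partial>\<sigma>)
          \<le> (\<integral>\<^sup>+x. enn_powr (A * u x) q +
              (\<Sum>k. enn_powr (2 ^ Suc k * (A * u x)) q * indicator (E k) x) \<partial>\<sigma>)"
      proof (rule nn_integral_mono)
        fix x
        have "0 < A * u x"
          using A u_pos[of x] by (simp add: ennreal_zero_less_mult_iff)
        from enn_powr_le_dyadic_sum[OF assms(3) this, of "frac_max \<alpha> \<nu> x"]
        show "enn_powr (frac_max \<alpha> \<nu> x) q \<le> enn_powr (A * u x) q +
            (\<Sum>k. enn_powr (2 ^ Suc k * (A * u x)) q * indicator (E k) x)"
          by (simp add: E_def indicator_def of_bool_def)
      qed
      also have "\<dots> = (\<integral>\<^sup>+x. enn_powr (A * u x) q \<partial>\<sigma>) +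
              (\<Sum>k. \<integral>\<^sup>+x. enn_powr (2 ^ Suc k * (A * u x)) q * indicator (E k) x \<partial>\<sigma>)"
        using E_borel by (subst nn_integral_add) (auto simp: sb nn_integral_suminf)
      also have "(\<integral>\<^sup>+x. enn_powr (A * u x) q \<partial>\<sigma>) = enn_powr A q * W"
        by (simp add: enn_powr_mult W_def nn_integral_cmult sb)
      \<comment> \<open>Scaling the levels by \<open>u x\<close> leaves a factor
        \<open>enn_powr (u x) q\<close>, which turns the \<sigma>-integral over \<open>E k\<close>
        into its \<omega>-mass.\<close>
      also have "(\<lambda>k. \<integral>\<^sup>+x. enn_powr (2 ^ Suc k * (A * u x)) q * indicator (E k) x \<partial>\<sigma>)
          = (\<lambda>k. enn_powr A q * (enn_powr (2 ^ Suc k) q * emeasure \<omega> (E k)))"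
      proof
        fix k
        have "(\<integral>\<^sup>+x. enn_powr (2 ^ Suc k * (A * u x)) q * indicator (E k) x \<partial>\<sigma>)
          = (\<integral>\<^sup>+x. (enn_powr A q * enn_powr (2 ^ Suc k) q) * (enn_powr (u x) q * indicator (E k) x) \<partial>\<sigma>)"
          unfolding enn_powr_mult by (intro nn_integral_cong) (simp add: ac_simps)
        then show "(\<integral>\<^sup>+x. enn_powr (2 ^ Suc k * (A * u x)) q * indicator (E k) x \<partial>\<sigma>)
          = enn_powr A q * (enn_powr (2 ^ Suc k) q * emeasure \<omega> (E k))"
          using E_borel[of k] by (simp add: nn_integral_cmult sb \<omega>_eq mult.assoc)
      qed
      also have "enn_powr A q * W + (\<Sum>k. enn_powr A q * (enn_powr (2 ^ Suc k) q * emeasure \<omega> (E k)))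
          = enn_powr A q * (W + (\<Sum>k. enn_powr (2 ^ Suc k) q * emeasure \<omega> (E k)))"
        by (simp add: distrib_left)
      also have "\<dots> \<le> enn_powr A q * (W + D)"
        unfolding D_def
      proof (intro mult_left_mono add_left_mono suminf_le summableI)
        fix k
        have "enn_powr (2 ^ Suc k) q * emeasure \<omega> (E k) \<le> enn_powr (ennreal (2 ^ Suc k)) q * ennreal (C / 2 ^ k)"
          using weak[of k] by (simp add: ennreal_power[symmetric] mult_left_mono del: ennreal_power power_Suc)
        also have "\<dots> = ennreal ((2 ^ Suc k) powr q * (C / 2 ^ k))"
          using C by (simp add: enn_powr_ennreal ennreal_mult[symmetric] del: power_Suc)
        also have "(2 ^ Suc k) powr q * (C / 2 ^ k) = 2 powr q * C * (2 powr (q - 1)) ^ k"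
        proof -
          have "(2 ^ Suc k :: real) powr q = 2 powr q * (2 powr q) ^ k"
            by (simp add: powr_mult powr_power powr_powr powr_realpow[symmetric] mult.commute)
          moreover have "(2 powr (q - 1)) ^ k = (2 powr q :: real) ^ k / 2 ^ k"
            by (simp add: powr_diff power_divide)
          ultimately show ?thesis by simp
        qed
        finally show "enn_powr (2 ^ Suc k) q * emeasure \<omega> (E k) \<le> ennreal (2 powr q * C * (2 powr (q - 1)) ^ k)" .
      qed simp
      also have "\<dots> \<le> enn_powr A q * ennreal (b + 1)"
        unfolding b(1) by (intro mult_left_mono ennreal_leI) auto
      also have "\<dots> = enn_powr (ennreal \<kappa> * A) q"
        using b assms(3) by (simp add: enn_powr_mult enn_powr_ennreal \<kappa>_def powr_powr mult.commute)
      finally show ?thesis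
        unfolding Lq_norm_def 3(1) A_def[symmetric] using assms(3)
        by (simp add: enn_powr_le_iff)
    qed
  qed
  then show ?thesis
    unfolding strong_type_def using \<kappa> by blast
qed

text \<open>The zero measure is excluded: for it the strong-type inequality is trivial, while every
  function vanishes almost everywhere. Limits are taken in [0, \<infinity>], where the increasing
  iterates converge to their supremum.\<close>

theorem theorem3p1:
  fixes \<sigma> :: "(real ^ 'n) measure" and q \<alpha> :: real
  assumes "\<sigma> \<in> loc_fin_measures" and "emeasure \<sigma> UNIV \<noteq> 0"
    and "0 < q" and "q < 1" and "0 \<le> \<alpha>" and "\<alpha> < real CARD('n)"
  shows "(strong_type \<alpha> q \<sigma> \<longleftrightarrow> (\<exists>u. supersolution \<alpha> q \<sigma> u)) \<and>
    (strong_type \<alpha> q \<sigma> \<longrightarrow>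
      (\<forall>j x. max_iter \<alpha> q \<sigma> j x \<le> max_iter \<alpha> q \<sigma> (Suc j) x) \<and>
      (\<exists>u. (\<forall>x. (\<lambda>j. max_iter \<alpha> q \<sigma> j x) \<longlonglongrightarrow> u x) \<and>
           supersolution \<alpha> q \<sigma> u \<and>
           (\<forall>x. u x \<ge> enn_powr (frac_max \<alpha> \<sigma> x) (1 / (1 - q)))))"
proof -
  have s: "sets \<sigma> = sets borel"
    using assms(1) by (simp add: loc_fin_measures_def)
  define u where "u x = (SUP j. max_iter \<alpha> q \<sigma> j x)" for x
  have mono: "max_iter \<alpha> q \<sigma> j x \<le> max_iter \<alpha> q \<sigma> (Suc j) x" for j x
    by (rule max_iter_mono[OF s assms(3,4)])
  have "(\<lambda>j. max_iter \<alpha> q \<sigma> j x) \<longlonglongrightarrow> u x" for x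
    unfolding u_def by (intro LIMSEQ_SUP incseq_SucI mono)
  moreover have "u x \<ge> enn_powr (frac_max \<alpha> \<sigma> x) (1 / (1 - q))" for x
    using SUP_upper[of 0 UNIV "\<lambda>j. max_iter \<alpha> q \<sigma> j x"] by (simp add: u_def)
  moreover have "supersolution \<alpha> q \<sigma> u" if "strong_type \<alpha> q \<sigma>"
    unfolding u_def by (rule strong_type_imp_supersolution[OF that assms(1-4)])
  moreover have "strong_type \<alpha> q \<sigma>" if "supersolution \<alpha> q \<sigma> v" for v
    by (rule supersolution_imp_strong_type[OF that s assms(3,4)])
  ultimately show ?thesis
    using mono by blast
qed

end
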